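(* Let $-\frac{\sqrt3}{2}<x<\frac{\sqrt3}{2}$ and write $x=\cos\frac{\alpha}{2}$ with $\frac{10\pi}{6}>\alpha>\frac{2\pi}{6}$. Then the image of the representation $\rho'_x=c\circ\rho_x:G(3_1)\to SO(3)$ is isomorphic to the holonomy of the 2-dimensional spherical cone-manifold $S^2_{\frac{2\pi}{2},\frac{2\pi}{3},\alpha}$.
   Context: $G(3_1)=\langle a,b\mid aba=bab\rangle$ is the trefoil knot group. $\mathbb H$ is the algebra of Hamilton quaternions with basis $1,i,j,ij$, where $i^2=j^2=-1$ and $ij=-ji$; $S^3$ is the group of unit quaternions; $H_0\cong E^3$ is the space of pure quaternions with the norm as quadratic form. The homomorphism $c:S^3\to SO(3)$ is $c(A)(v)=Av\overline{A}$ for $v\in H_0$. For $-\frac{\sqrt3}{2}<x<\frac{\sqrt3}{2}$ the representation $\rho_x:G(3_1)\to S^3$ is $$\rho_x(a)=x+\frac{2x^2-1}{2\sqrt{1-x^2}}\,i+\frac12\sqrt{\frac{3-4x^2}{1-x^2}}\,j,\qquad \rho_x(b)=x+\sqrt{1-x^2}\,i .$$ The spherical cone-manifold $S^2_{\frac{2\pi}{2},\frac{2\pi}{3},\alpha}$ is the 2-sphere with three cone points of cone angles $\pi$, $\frac{2\pi}{3}$, $\alpha$. It is obtained from the spherical triangle $PQR$ with angle $\frac{2\pi}{3}$ at $R$ and angles $\frac{\alpha}{2}$ at $P$ and $Q$ by identifying the edge $RP$ with the edge $RQ$ via the rotation about $R$, and folding the edge $PQ$ about its midpoint via the rotation of angle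 $\pi$. Its holonomy is the subgroup of $SO(3)$ generated by the rotations of angle $\alpha$ about $P$ and about $Q$. *)

theory Defs
  imports "HOL-Analysis.Analysis" "HOL-Algebra.Algebra"
begin

unbundle no set_product_syntax
unbundle cross3_syntax

section \<open>Group presentations\<close>

text \<open>
  A letter \<open>(g, True)\<close> stands for the generator \<open>g\<close>, a letter \<open>(g, False)\<close> for its formal inverse.
  A set \<open>R\<close> of pairs of words is read as a set of relations \<open>u = v\<close>.
\<close>

type_synonym 'g gword = "('g \<times> bool) list"

inductive word_equiv :: "('g gword \<times> 'g gword) set \<Rightarrow> 'g gword \<Rightarrow> 'g gword \<Rightarrow> bool"
  for R :: "('g gword \<times> 'g gword) set"
where
  refl: "word_equiv R w w"
| sym: "word_equiv R u v \<Longrightarrow> word_equiv R v u"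
| trans: "word_equiv R u v \<Longrightarrow> word_equiv R v w \<Longrightarrow> word_equiv R u w"
| cancel: "word_equiv R (u @ [(g, e), (g, \<not> e)] @ v) (u @ v)"
| relation: "(r, s) \<in> R \<Longrightarrow> word_equiv R (u @ r @ v) (u @ s @ v)"

definition word_class :: "('g gword \<times> 'g gword) set \<Rightarrow> 'g gword \<Rightarrow> 'g gword set" where
  "word_class R w = {v. word_equiv R w v}"

definition presented_group :: "('g gword \<times> 'g gword) set \<Rightarrow> 'g gword set monoid" where
  "presented_group R =
     \<lparr>carrier = range (word_class R),
      mult = (\<lambda>C D. \<Union>u\<in>C. \<Union>v\<in>D. word_class R (u @ v)),
      one = word_class R []\<rparr>"

fun word_eval :: "('h, 'm) monoid_scheme \<Rightarrow> ('g \<Rightarrow> 'h) \<Rightarrow> 'g gword \<Rightarrow> 'h" where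
  "word_eval H f [] = \<one>\<^bsub>H\<^esub>"
| "word_eval H f ((g, e) # w) =
     (if e then f g else inv\<^bsub>H\<^esub> (f g)) \<otimes>\<^bsub>H\<^esub> word_eval H f w"

text \<open>
  The choice of representative below is immaterial whenever \<open>f\<close> respects the relations;
  see \<open>induced_map_class\<close> and \<open>induced_map_hom\<close>.
\<close>

definition induced_map :: "('h, 'm) monoid_scheme \<Rightarrow> ('g \<Rightarrow> 'h) \<Rightarrow> 'g gword set \<Rightarrow> 'h" where
  "induced_map H f C = word_eval H f (SOME w. w \<in> C)"

lemma word_equiv_append_left: "word_equiv R u v \<Longrightarrow> word_equiv R (x @ u) (x @ v)"
proof (induction rule: word_equiv.induct)
  case (cancel u g e v)
  show ?case using word_equiv.cancel[of R "x @ u" g e v] by simp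
next
  case (relation r s u v)
  then show ?case using word_equiv.relation[of r s R "x @ u" v] by simp
qed (auto intro: word_equiv.intros)

lemma word_equiv_append_right: "word_equiv R u v \<Longrightarrow> word_equiv R (u @ x) (v @ x)"
proof (induction rule: word_equiv.induct)
  case (cancel u g e v)
  show ?case using word_equiv.cancel[of R u g e "v @ x"] by simp
next
  case (relation r s u v)
  then show ?case using word_equiv.relation[of r s R u "v @ x"] by simp
qed (auto intro: word_equiv.intros)

lemma word_equiv_append:
  "word_equiv R u u' \<Longrightarrow> word_equiv R v v' \<Longrightarrow> word_equiv R (u @ v) (u' @ v')"
  by (meson word_equiv.trans word_equiv_append_left word_equiv_append_right)

lemma word_class_eq_iff: "word_class R u = word_class R v \<longleftrightarrow> word_equiv R u v"
  unfolding word_class_def using word_equiv.intros(1-3)[of R] by blast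

lemma presented_group_mult [simp]:
  "word_class R u \<otimes>\<^bsub>presented_group R\<^esub> word_class R v = word_class R (u @ v)"
proof -
  have "word_class R (u' @ v') = word_class R (u @ v)"
    if "u' \<in> word_class R u" "v' \<in> word_class R v" for u' v'
  proof -
    have "word_equiv R u u'" "word_equiv R v v'" using that by (simp_all add: word_class_def)
    then have "word_equiv R (u @ v) (u' @ v')" by (rule word_equiv_append)
    then show ?thesis by (simp add: word_class_eq_iff word_equiv.sym)
  qed
  moreover have "u \<in> word_class R u" "v \<in> word_class R v"
    by (simp_all add: word_class_def word_equiv.refl)
  ultimately have "(\<Union>u'\<in>word_class R u. \<Union>v'\<in>word_class R v. word_class R (u' @ v')) =
    word_class R (u @ v)" by blast
  then show ?thesis by (simp add: presented_group_def)
qed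

lemma presented_group_one: "\<one>\<^bsub>presented_group R\<^esub> = word_class R []"
  and presented_group_carrier: "carrier (presented_group R) = range (word_class R)"
  by (simp_all add: presented_group_def)

lemma word_equiv_inverse:
  "word_equiv R (rev (map (\<lambda>(g, e). (g, \<not> e)) w) @ w) []"
proof (induction w)
  case Nil
  show ?case by (simp add: word_equiv.refl)
next
  case (Cons l w)
  obtain g e where l: "l = (g, e)" by (cases l)
  have "word_equiv R (rev (map (\<lambda>(g, e). (g, \<not> e)) w) @ [(g, \<not> e), (g, \<not> \<not> e)] @ w)
      (rev (map (\<lambda>(g, e). (g, \<not> e)) w) @ w)"
    by (rule word_equiv.cancel)
  then have "word_equiv R (rev (map (\<lambda>(g, e). (g, \<not> e)) w) @ [(g, \<not> e), (g, \<not> \<not> e)] @ w) []"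
    using Cons by (rule word_equiv.trans)
  then show ?case by (simp add: l)
qed

lemma group_presented_group: "group (presented_group R)"
proof (rule groupI)
  fix C assume "C \<in> carrier (presented_group R)"
  then obtain w where "C = word_class R w" by (auto simp: presented_group_carrier)
  then show "\<exists>D\<in>carrier (presented_group R). D \<otimes>\<^bsub>presented_group R\<^esub> C = \<one>\<^bsub>presented_group R\<^esub>"
    by (intro bexI[of _ "word_class R (rev (map (\<lambda>(g, e). (g, \<not> e)) w))"])
       (auto simp: presented_group_carrier presented_group_one word_class_eq_iff word_equiv_inverse)
qed (auto simp: presented_group_carrier presented_group_one)

lemma word_eval_append:
  assumes "group H" "\<And>g. f g \<in> carrier H"
  shows "word_eval H f u \<in> carrier H \<and>
    word_eval H f (u @ v) = word_eval H f u \<otimes>\<^bsub>H\<^esub> word_eval H f v"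
proof -
  interpret H: group H by fact
  have c: "word_eval H f w \<in> carrier H" for w
    by (induction w) (auto simp: assms(2))
  show ?thesis
    by (induction u) (auto simp: assms(2) c H.m_assoc)
qed

lemma word_eval_cong:
  assumes "group H" "\<And>g. f g \<in> carrier H"
    and "\<And>r s. (r, s) \<in> R \<Longrightarrow> word_eval H f r = word_eval H f s"
    and "word_equiv R u v"
  shows "word_eval H f u = word_eval H f v"
proof -
  interpret H: group H by fact
  note app = word_eval_append[of H f, OF assms(1,2)]
  have c: "word_eval H f w \<in> carrier H" for w using app by blast
  from assms(4) show ?thesis
  proof (induction rule: word_equiv.induct)
    case (cancel u g e v)
    have "word_eval H f [(g, e), (g, \<not> e)] = \<one>\<^bsub>H\<^esub>"
      using assms(2)[of g] by auto
    then show ?case by (metis app H.l_one c)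
  next
    case (relation r s u v)
    then show ?case by (metis app assms(3))
  qed auto
qed

lemma induced_map_class:
  assumes "group H" "\<And>g. f g \<in> carrier H"
    and "\<And>r s. (r, s) \<in> R \<Longrightarrow> word_eval H f r = word_eval H f s"
  shows "induced_map H f (word_class R w) = word_eval H f w"
proof -
  have "w \<in> word_class R w" by (simp add: word_class_def word_equiv.refl)
  then have "(SOME v. v \<in> word_class R w) \<in> word_class R w" by (rule someI)
  then show ?thesis
    unfolding induced_map_def using word_eval_cong[OF assms] by (simp add: word_class_def)
qed

lemma induced_map_hom:
  assumes "group H" "\<And>g. f g \<in> carrier H"
    and "\<And>r s. (r, s) \<in> R \<Longrightarrow> word_eval H f r = word_eval H f s"
  shows "induced_map H f \<in> hom (presented_group R) H"
proof -
  have "word_eval H f u \<in> carrier H \<and>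
      word_eval H f (u @ v) = word_eval H f u \<otimes>\<^bsub>H\<^esub> word_eval H f v" for u v
    by (rule word_eval_append[of H f, OF assms(1,2)])
  then show ?thesis
    by (auto simp: hom_def presented_group_carrier induced_map_class[of H f R, OF assms])
qed

section \<open>The trefoil knot group\<close>

datatype trefoil_gen = Gen_a | Gen_b

definition trefoil_group :: "trefoil_gen gword set monoid" where
  "trefoil_group = presented_group
     {([(Gen_a, True), (Gen_b, True), (Gen_a, True)], [(Gen_b, True), (Gen_a, True), (Gen_b, True)])}"

section \<open>Hamilton quaternions\<close>

text \<open>\<open>Quat p q r s\<close> is \<open>p + q i + r j + s ij\<close>.\<close>

datatype quat = Quat (qre: real) (qi: real) (qj: real) (qij: real)

instantiation quat :: ring_1
begin

definition "0 = Quat 0 0 0 0"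
definition "1 = Quat 1 0 0 0"
definition "x + y = Quat (qre x + qre y) (qi x + qi y) (qj x + qj y) (qij x + qij y)"
definition "- x = Quat (- qre x) (- qi x) (- qj x) (- qij x)"
definition "x - y = Quat (qre x - qre y) (qi x - qi y) (qj x - qj y) (qij x - qij y)"
definition "x * y = Quat
  (qre x * qre y - qi x * qi y - qj x * qj y - qij x * qij y)
  (qre x * qi y + qi x * qre y + qj x * qij y - qij x * qj y)
  (qre x * qj y - qi x * qij y + qj x * qre y + qij x * qi y)
  (qre x * qij y + qi x * qj y - qj x * qi y + qij x * qre y)"

instance
  by standard
    (simp_all add: zero_quat_def one_quat_def plus_quat_def uminus_quat_def minus_quat_def
      times_quat_def algebra_simps)

end

lemmas quat_defs = zero_quat_def one_quat_def plus_quat_def uminus_quat_def minus_quat_def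
  times_quat_def

lemma quat_basis_relations:
  "Quat 0 1 0 0 * Quat 0 1 0 0 = - 1"
  "Quat 0 0 1 0 * Quat 0 0 1 0 = - 1"
  "Quat 0 1 0 0 * Quat 0 0 1 0 = Quat 0 0 0 1"
  "Quat 0 0 1 0 * Quat 0 1 0 0 = - Quat 0 0 0 1"
  by (simp_all add: quat_defs)

definition qcnj :: "quat \<Rightarrow> quat" where
  "qcnj q = Quat (qre q) (- qi q) (- qj q) (- qij q)"

definition qnorm :: "quat \<Rightarrow> real" where
  "qnorm q = sqrt ((qre q)\<^sup>2 + (qi q)\<^sup>2 + (qj q)\<^sup>2 + (qij q)\<^sup>2)"

definition S3 :: "quat monoid" where
  "S3 = \<lparr>carrier = {q. qnorm q = 1}, mult = (*), one = 1\<rparr>"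

text \<open>Pure quaternions are identified with \<open>real ^ 3\<close> through the orthonormal basis \<open>i, j, ij\<close>.\<close>

definition quat_of_vec :: "real ^ 3 \<Rightarrow> quat" where
  "quat_of_vec v = Quat 0 (v $ 1) (v $ 2) (v $ 3)"

definition vec_of_quat :: "quat \<Rightarrow> real ^ 3" where
  "vec_of_quat q = vector [qi q, qj q, qij q]"

definition SO3 :: "(real ^ 3 \<Rightarrow> real ^ 3) monoid" where
  "SO3 = \<lparr>carrier = {f. orthogonal_transformation f \<and> det (matrix f) = 1},
          mult = (\<circ>), one = id\<rparr>"

definition quat_conj :: "quat \<Rightarrow> real ^ 3 \<Rightarrow> real ^ 3" where
  "quat_conj A = (\<lambda>v. vec_of_quat (A * quat_of_vec v * qcnj A))"

fun trefoil_gen_image :: "real \<Rightarrow> trefoil_gen \<Rightarrow> quat" where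
  "trefoil_gen_image x Gen_a =
     Quat x ((2 * x\<^sup>2 - 1) / (2 * sqrt (1 - x\<^sup>2))) (1 / 2 * sqrt ((3 - 4 * x\<^sup>2) / (1 - x\<^sup>2))) 0"
| "trefoil_gen_image x Gen_b = Quat x (sqrt (1 - x\<^sup>2)) 0 0"

definition trefoil_rep :: "real \<Rightarrow> trefoil_gen gword set \<Rightarrow> quat" where
  "trefoil_rep x = induced_map S3 (trefoil_gen_image x)"

lemma qnorm_eq_1_iff: "qnorm q = 1 \<longleftrightarrow> (qre q)\<^sup>2 + (qi q)\<^sup>2 + (qj q)\<^sup>2 + (qij q)\<^sup>2 = 1"
  by (simp add: qnorm_def)

lemma quat_conj_pure: "qre (A * quat_of_vec v * qcnj A) = 0"
  by (simp add: times_quat_def quat_of_vec_def qcnj_def algebra_simps)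

lemma group_S3: "group S3"
proof (rule groupI)
  fix p q assume pq: "p \<in> carrier S3" "q \<in> carrier S3"
  have "(qre (p * q))\<^sup>2 + (qi (p * q))\<^sup>2 + (qj (p * q))\<^sup>2 + (qij (p * q))\<^sup>2 =
    ((qre p)\<^sup>2 + (qi p)\<^sup>2 + (qj p)\<^sup>2 + (qij p)\<^sup>2) * ((qre q)\<^sup>2 + (qi q)\<^sup>2 + (qj q)\<^sup>2 + (qij q)\<^sup>2)"
    unfolding times_quat_def quat.sel by Groebner_Basis.algebra
  with pq show "p \<otimes>\<^bsub>S3\<^esub> q \<in> carrier S3" by (simp add: S3_def qnorm_eq_1_iff)
next
  fix p assume p: "p \<in> carrier S3"
  then have "qcnj p * p = 1" "qcnj p \<in> carrier S3"
    by (simp_all add: S3_def qnorm_eq_1_iff qcnj_def quat_defs power2_eq_square algebra_simps)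
  then show "\<exists>q\<in>carrier S3. q \<otimes>\<^bsub>S3\<^esub> p = \<one>\<^bsub>S3\<^esub>" by (auto simp: S3_def)
qed (simp_all add: S3_def qnorm_def mult.assoc, simp add: one_quat_def)

lemma trefoil_rep_range:
  assumes "- (sqrt 3 / 2) < x" "x < sqrt 3 / 2"
  shows "4 * x\<^sup>2 < 3"
proof -
  have "\<bar>x\<bar> < sqrt 3 / 2" using assms by linarith
  then have "\<bar>x\<bar>\<^sup>2 < (sqrt 3 / 2)\<^sup>2" by (rule power_strict_mono) auto
  then show ?thesis by (simp add: power_divide)
qed

lemma trefoil_gen_image_S3:
  assumes "- (sqrt 3 / 2) < x" "x < sqrt 3 / 2"
  shows "trefoil_gen_image x g \<in> carrier S3"
proof (cases g)
  case Gen_a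
  have "1 - x\<^sup>2 > 0" "3 - 4 * x\<^sup>2 > 0" using trefoil_rep_range[OF assms] by auto
  then show ?thesis
    by (simp add: Gen_a S3_def qnorm_eq_1_iff power_divide power_mult_distrib real_sqrt_pow2
        divide_simps) Groebner_Basis.algebra
next
  case Gen_b
  have "1 - x\<^sup>2 > 0" using trefoil_rep_range[OF assms] by auto
  then show ?thesis by (simp add: Gen_b S3_def qnorm_eq_1_iff)
qed

lemma trefoil_rep_relation:
  fixes x :: real
  assumes "- (sqrt 3 / 2) < x" "x < sqrt 3 / 2"
  shows "trefoil_gen_image x Gen_a * (trefoil_gen_image x Gen_b * trefoil_gen_image x Gen_a) =
    trefoil_gen_image x Gen_b * (trefoil_gen_image x Gen_a * trefoil_gen_image x Gen_b)"
proof -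
  define s where "s = sqrt (1 - x\<^sup>2)"
  define p where "p = (2 * x\<^sup>2 - 1) / (2 * s)"
  define t where "t = 1 / 2 * sqrt ((3 - 4 * x\<^sup>2) / (1 - x\<^sup>2))"
  have pos: "1 - x\<^sup>2 > 0" "3 - 4 * x\<^sup>2 > 0" using trefoil_rep_range[OF assms] by auto
  have s: "s * s = 1 - x\<^sup>2" "s > 0" using pos by (simp_all add: s_def)
  have ps: "2 * (p * s) = 2 * x\<^sup>2 - 1" using s by (simp add: p_def)
  have n: "x\<^sup>2 + p\<^sup>2 + t\<^sup>2 = 1"
    using trefoil_gen_image_S3[OF assms, of Gen_a]
    by (simp add: S3_def qnorm_eq_1_iff p_def s_def t_def)
  have a: "trefoil_gen_image x Gen_a = Quat x p t 0" and b: "trefoil_gen_image x Gen_b = Quat x s 0 0"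
    by (simp_all add: p_def s_def t_def)
  have tt: "t * t = 1 - x\<^sup>2 - p * p" using n by (simp add: power2_eq_square)
  have re: "x * (x * x - s * p) - p * (x * p + s * x) - t * (x * t) =
    x * (x * x - p * s) - s * (x * s + p * x)"
    using s(1) tt by Groebner_Basis.algebra
  have im: "x * (x * p + s * x) + p * (x * x - s * p) + t * (s * t) =
    x * (x * s + p * x) + s * (x * x - p * s)"
    using s(1) ps tt by Groebner_Basis.algebra
  have jm: "x * (x * t) - p * (s * t) + t * (x * x - s * p) = x * (t * x) - s * (- (t * s))"
    using s(1) ps tt by Groebner_Basis.algebra
  have km: "x * (s * t) + p * (x * t) - t * (x * p + s * x) = x * (- (t * s)) + s * (t * x)"
    by Groebner_Basis.algebra
  show ?thesis
    unfolding a b times_quat_def quat.sel quat.inject using re im jm km by simp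
qed

lemma trefoil_rep_hom:
  assumes "- (sqrt 3 / 2) < x" "x < sqrt 3 / 2"
  shows "trefoil_rep x \<in> hom trefoil_group S3"
  unfolding trefoil_rep_def trefoil_group_def
proof (rule induced_map_hom[OF group_S3])
  fix r s
  assume "(r, s) \<in> {([(Gen_a, True), (Gen_b, True), (Gen_a, True)],
    [(Gen_b, True), (Gen_a, True), (Gen_b, True)])}"
  then show "word_eval S3 (trefoil_gen_image x) r = word_eval S3 (trefoil_gen_image x) s"
    using trefoil_rep_relation[OF assms] by (simp add: S3_def del: trefoil_gen_image.simps)
qed (rule trefoil_gen_image_S3[OF assms])

section \<open>Spherical triangles and the holonomy of the cone-manifold\<close>

text \<open>Rodrigues' formula, for a unit vector \<open>p\<close>.\<close>

definition axis_rotation :: "real ^ 3 \<Rightarrow> real \<Rightarrow> real ^ 3 \<Rightarrow> real ^ 3" where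
  "axis_rotation p \<theta> =
     (\<lambda>v. cos \<theta> *\<^sub>R v + sin \<theta> *\<^sub>R (p \<times> v) + ((1 - cos \<theta>) * (p \<bullet> v)) *\<^sub>R p)"

text \<open>
  The angle at \<open>A\<close> between the great circle arcs \<open>AB\<close> and \<open>AC\<close>, i.e. the angle between their
  initial directions in the tangent plane of the unit sphere at \<open>A\<close>.
\<close>

definition spherical_angle :: "real ^ 3 \<Rightarrow> real ^ 3 \<Rightarrow> real ^ 3 \<Rightarrow> real" where
  "spherical_angle A B C =
     (let u = B - (A \<bullet> B) *\<^sub>R A; v = C - (A \<bullet> C) *\<^sub>R A
      in arccos ((u \<bullet> v) / (norm u * norm v)))"

text \<open>
  The triangle whose gluing gives the cone-manifold with cone angles \<open>\<pi>\<close>, \<open>2\<pi>/3\<close>, \<open>\<alpha>\<close>.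
  It is isosceles with apex \<open>R\<close>, so the gluings of the edge \<open>RP\<close> to \<open>RQ\<close> and of \<open>PQ\<close> to itself
  are determined by it. The last condition says that the triangle is nondegenerate.
\<close>

definition cone_triangle :: "real \<Rightarrow> real ^ 3 \<Rightarrow> real ^ 3 \<Rightarrow> real ^ 3 \<Rightarrow> bool" where
  "cone_triangle \<alpha> P Q R \<longleftrightarrow>
     norm P = 1 \<and> norm Q = 1 \<and> norm R = 1 \<and>
     spherical_angle R P Q = 2 * pi / 3 \<and>
     spherical_angle P Q R = \<alpha> / 2 \<and>
     spherical_angle Q R P = \<alpha> / 2 \<and>
     P \<bullet> (Q \<times> R) \<noteq> 0"

definition cone_holonomy :: "real \<Rightarrow> real ^ 3 \<Rightarrow> real ^ 3 \<Rightarrow> (real ^ 3 \<Rightarrow> real ^ 3) set" where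
  "cone_holonomy \<alpha> P Q = generate SO3 {axis_rotation P \<alpha>, axis_rotation Q \<alpha>}"

text \<open>The following facts check that the definitions above are consistent.\<close>

lemma group_SO3: "group SO3"
proof (rule groupI)
  fix f g assume "f \<in> carrier SO3" "g \<in> carrier SO3"
  then show "f \<otimes>\<^bsub>SO3\<^esub> g \<in> carrier SO3"
    by (simp add: SO3_def orthogonal_transformation_compose matrix_compose det_mul
        orthogonal_transformation_linear)
next
  fix f assume f: "f \<in> carrier SO3"
  then have o: "orthogonal_transformation f" and d: "det (matrix f) = 1" by (simp_all add: SO3_def)
  have o': "orthogonal_transformation (inv_into UNIV f)"
    using o by (rule orthogonal_transformation_inv)
  have i: "inv_into UNIV f \<circ> f = id"
    using orthogonal_transformation_inj[OF o] by simp
  have "det (matrix (inv_into UNIV f)) * det (matrix f) = 1"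
    unfolding det_mul[symmetric]
      matrix_compose[OF orthogonal_transformation_linear[OF o]
        orthogonal_transformation_linear[OF o'], symmetric] i by simp
  with o' d i show "\<exists>g\<in>carrier SO3. g \<otimes>\<^bsub>SO3\<^esub> f = \<one>\<^bsub>SO3\<^esub>"
    by (intro bexI[of _ "inv_into UNIV f"]) (simp_all add: SO3_def)
qed (auto simp: SO3_def orthogonal_transformation_id[folded id_def] comp_assoc)

lemma matrix_entry: "matrix f $ k $ l = f (axis l 1) $ k"
  by (simp add: matrix_def)

lemma quat_conj_SO3:
  assumes "A \<in> carrier S3"
  shows "quat_conj A \<in> carrier SO3"
proof -
  obtain p q r s where A: "A = Quat p q r s" by (cases A)
  have n: "p\<^sup>2 + q\<^sup>2 + r\<^sup>2 + s\<^sup>2 = 1" using assms by (simp add: S3_def qnorm_eq_1_iff A)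
  have comp: "quat_conj A v = vector
     [(p\<^sup>2 + q\<^sup>2 - r\<^sup>2 - s\<^sup>2) * v $ 1 + 2 * (q * r - p * s) * v $ 2 + 2 * (q * s + p * r) * v $ 3,
      2 * (q * r + p * s) * v $ 1 + (p\<^sup>2 - q\<^sup>2 + r\<^sup>2 - s\<^sup>2) * v $ 2 + 2 * (r * s - p * q) * v $ 3,
      2 * (q * s - p * r) * v $ 1 + 2 * (r * s + p * q) * v $ 2 + (p\<^sup>2 - q\<^sup>2 - r\<^sup>2 + s\<^sup>2) * v $ 3]" for v
    by (simp add: A quat_conj_def vec_of_quat_def quat_of_vec_def qcnj_def times_quat_def
        vec_eq_iff forall_3 power2_eq_square algebra_simps)
  have lin: "linear (quat_conj A)"
    by (rule linearI) (simp_all add: comp vec_eq_iff forall_3 algebra_simps)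
  have "norm (quat_conj A v) = norm v" for v
  proof -
    have "quat_conj A v \<bullet> quat_conj A v = (p\<^sup>2 + q\<^sup>2 + r\<^sup>2 + s\<^sup>2)\<^sup>2 * (v \<bullet> v)"
      unfolding comp inner_vec_def sum_3 vector_3 inner_real_def by Groebner_Basis.algebra
    then show ?thesis by (simp add: n norm_eq_sqrt_inner)
  qed
  then have "orthogonal_transformation (quat_conj A)"
    using lin by (simp add: orthogonal_transformation)
  moreover have "det (matrix (quat_conj A)) = (p\<^sup>2 + q\<^sup>2 + r\<^sup>2 + s\<^sup>2) ^ 3"
    unfolding det_3 matrix_entry comp vector_3 axis_def vec_lambda_beta
    by simp Groebner_Basis.algebra
  ultimately show ?thesis by (simp add: SO3_def n)
qed

lemma quat_conj_mult: "quat_conj (A * B) = quat_conj A \<circ> quat_conj B"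
proof
  fix v
  have q: "quat_of_vec (vec_of_quat z) = z" if "qre z = 0" for z
    using that by (cases z) (simp add: quat_of_vec_def vec_of_quat_def)
  have c: "qcnj (A * B) = qcnj B * qcnj A"
    by (simp add: qcnj_def times_quat_def algebra_simps)
  show "quat_conj (A * B) v = (quat_conj A \<circ> quat_conj B) v"
    using q[OF quat_conj_pure[of B v]] by (simp add: quat_conj_def c mult.assoc)
qed

lemma quat_conj_hom: "quat_conj \<in> hom S3 SO3"
  using quat_conj_SO3 by (auto simp: hom_def quat_conj_mult S3_def SO3_def)

lemma axis_rotation_eq_quat_conj:
  assumes "norm P = 1"
  shows "axis_rotation P \<alpha> =
    quat_conj (Quat (cos (\<alpha> / 2)) (sin (\<alpha> / 2) * P $ 1) (sin (\<alpha> / 2) * P $ 2) (sin (\<alpha> / 2) * P $ 3))"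
proof
  fix v
  define c where "c = cos (\<alpha> / 2)"
  define s where "s = sin (\<alpha> / 2)"
  have cs: "c\<^sup>2 + s\<^sup>2 = 1" by (simp add: c_def s_def)
  have C: "cos \<alpha> = c\<^sup>2 - s\<^sup>2" using cos_double[of "\<alpha> / 2"] by (simp add: c_def s_def)
  have S: "sin \<alpha> = 2 * s * c" using sin_double[of "\<alpha> / 2"] by (simp add: c_def s_def)
  have "P \<bullet> P = 1" using assms by (simp add: norm_eq_1)
  then have P: "(P $ 1)\<^sup>2 + (P $ 2)\<^sup>2 + (P $ 3)\<^sup>2 = 1"
    by (simp add: inner_vec_def sum_3 power2_eq_square)
  have D: "1 - cos \<alpha> = 2 * s\<^sup>2" using cs C by simp
  have P1: "(P $ 1)\<^sup>2 = 1 - (P $ 2)\<^sup>2 - (P $ 3)\<^sup>2" using P by simp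
  have "axis_rotation P \<alpha> v = quat_conj (Quat c (s * P $ 1) (s * P $ 2) (s * P $ 3)) v"
    unfolding axis_rotation_def D
    unfolding C S quat_conj_def vec_of_quat_def quat_of_vec_def qcnj_def
      times_quat_def quat.sel cross3_def vec_eq_iff forall_3 inner_vec_def sum_3
      vector_add_component vector_scaleR_component vector_3 inner_real_def real_scaleR_def
    by (intro conjI) (use P1 in Groebner_Basis.algebra)+
  then show "axis_rotation P \<alpha> v = quat_conj (Quat (cos (\<alpha> / 2)) (sin (\<alpha> / 2) * P $ 1)
      (sin (\<alpha> / 2) * P $ 2) (sin (\<alpha> / 2) * P $ 3)) v"
    by (simp add: c_def s_def)
qed

lemma axis_rotation_SO3:
  assumes "norm P = 1"
  shows "axis_rotation P \<alpha> \<in> carrier SO3"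
proof -
  have "P \<bullet> P = 1" using assms by (simp add: norm_eq_1)
  then have P: "(P $ 1)\<^sup>2 + (P $ 2)\<^sup>2 + (P $ 3)\<^sup>2 = 1"
    by (simp add: inner_vec_def sum_3 power2_eq_square)
  have "(cos (\<alpha> / 2))\<^sup>2 + (sin (\<alpha> / 2))\<^sup>2 * ((P $ 1)\<^sup>2 + (P $ 2)\<^sup>2 + (P $ 3)\<^sup>2) = 1"
    by (simp add: P)
  then show ?thesis
    unfolding axis_rotation_eq_quat_conj[OF assms]
    by (intro quat_conj_SO3) (simp add: S3_def qnorm_eq_1_iff power_mult_distrib algebra_simps)
qed

lemma cone_triangle_exists:
  assumes "2 * pi / 6 < \<alpha>" "\<alpha> < 10 * pi / 6"
  shows "\<exists>P Q R. cone_triangle \<alpha> P Q R"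
proof -
  define x where "x = cos (\<alpha> / 2)"
  have "cos (5 * pi / 6) < x" "x < cos (pi / 6)"
    unfolding x_def using assms by (auto intro!: cos_monotone_0_pi)
  moreover have "cos (5 * pi / 6) = - (sqrt 3 / 2)"
    using cos_pi_minus[of "pi / 6"] by (simp add: cos_30 field_simps)
  ultimately have x: "4 * x\<^sup>2 < 3"
    by (intro trefoil_rep_range) (simp_all add: cos_30)
  define w where "w = sqrt (3 * (1 - x\<^sup>2))"
  have w2: "w\<^sup>2 = 3 * (1 - x\<^sup>2)" and w: "w > 0" using x by (simp_all add: w_def)
  define t where "t = x / w"
  have xt: "x = w * t" using w by (simp add: t_def)
  have t2: "w\<^sup>2 * (1 + 3 * t\<^sup>2) = 3" using w2 unfolding xt by Groebner_Basis.algebra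
  have t1: "t\<^sup>2 < 1" using x w2 w by (simp add: t_def power_divide)
  define s where "s = sqrt (1 - t\<^sup>2)"
  have s2: "s\<^sup>2 = 1 - t\<^sup>2" and s: "s > 0" using t1 by (simp_all add: s_def)
  define z where "z = sqrt 3"
  have z2: "z\<^sup>2 = 3" and z: "z > 0" by (simp_all add: z_def)
  define P Q R :: "real ^ 3" where "P = vector [s, 0, t]"
    and "Q = vector [- s / 2, s * z / 2, t]" and "R = vector [0, 0, 1]"
  note PQR = P_def Q_def R_def
  note ev = inner_vec_def sum_3 vector_3 inner_real_def
  have PP: "P \<bullet> P = 1" unfolding PQR ev using s2 by Groebner_Basis.algebra
  have QQ: "Q \<bullet> Q = 1" unfolding PQR ev using s2 z2 by (simp add: power2_eq_square field_simps)
  have RR: "R \<bullet> R = 1" by (simp add: PQR ev)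
  have PQ: "P \<bullet> Q = t\<^sup>2 - s\<^sup>2 / 2" by (simp add: PQR ev power2_eq_square)
  have PR: "P \<bullet> R = t" and QR: "Q \<bullet> R = t" by (simp_all add: PQR ev)
  have angle: "spherical_angle A B C =
      arccos ((B \<bullet> C - (A \<bullet> B) * (A \<bullet> C)) / sqrt ((1 - (A \<bullet> B)\<^sup>2) * (1 - (A \<bullet> C)\<^sup>2)))"
    if "A \<bullet> A = 1" "B \<bullet> B = 1" "C \<bullet> C = 1" for A B C :: "real ^ 3"
  proof -
    have nm: "norm (V - (A \<bullet> V) *\<^sub>R A) = sqrt (1 - (A \<bullet> V)\<^sup>2)" if "V \<bullet> V = 1" for V
      using that \<open>A \<bullet> A = 1\<close>
      by (simp add: norm_eq_sqrt_inner inner_diff_left inner_diff_right inner_commute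
          power2_eq_square)
    have "(B - (A \<bullet> B) *\<^sub>R A) \<bullet> (C - (A \<bullet> C) *\<^sub>R A) = B \<bullet> C - (A \<bullet> B) * (A \<bullet> C)"
      using \<open>A \<bullet> A = 1\<close> by (simp add: inner_diff_left inner_diff_right inner_commute)
    then show ?thesis
      unfolding spherical_angle_def Let_def nm[OF that(2)] nm[OF that(3)]
      by (simp add: real_sqrt_mult)
  qed
  have "(P \<bullet> Q - t * t) / sqrt ((1 - t\<^sup>2) * (1 - t\<^sup>2)) = - (1 / 2)"
    unfolding PQ s2[symmetric] using s by (simp add: power2_eq_square)
  then have aR: "spherical_angle R P Q = 2 * pi / 3"
    unfolding angle[OF RR PP QQ] using cos_120 arccos_cos[of "2 * pi / 3"]
    by (simp add: inner_commute[of R] PR QR)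
  have rt: "(1 - (P \<bullet> Q)\<^sup>2) * (1 - t\<^sup>2) = (3 * s\<^sup>2 / (2 * w))\<^sup>2"
  proof -
    have "4 * (1 - (P \<bullet> Q)\<^sup>2) = 3 * s\<^sup>2 * (1 + 3 * t\<^sup>2)"
      unfolding PQ power2_diff using s2 by (simp add: power2_eq_square) (simp add: algebra_simps)
    moreover have "1 + 3 * t\<^sup>2 = 3 / w\<^sup>2" using t2 w by (simp add: field_simps)
    ultimately have "4 * (1 - (P \<bullet> Q)\<^sup>2) = 9 * s\<^sup>2 / w\<^sup>2" by simp
    then have "1 - (P \<bullet> Q)\<^sup>2 = 9 * s\<^sup>2 / (4 * w\<^sup>2)" by simp
    then show ?thesis unfolding s2[symmetric]
      by (simp add: power2_eq_square)
  qed
  have q: "(t - (P \<bullet> Q) * t) / sqrt ((1 - (P \<bullet> Q)\<^sup>2) * (1 - t\<^sup>2)) = x"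
  proof -
    have n: "t - (P \<bullet> Q) * t = 3 * t * s\<^sup>2 / 2" unfolding PQ s2
      by (simp add: field_simps power2_eq_square)
    have d: "sqrt ((1 - (P \<bullet> Q)\<^sup>2) * (1 - t\<^sup>2)) = 3 * s\<^sup>2 / (2 * w)"
      unfolding rt using w by simp
    show ?thesis unfolding n d xt using s w by (simp add: field_simps)
  qed
  have ax: "arccos x = \<alpha> / 2" unfolding x_def using assms by (intro arccos_cos) auto
  have aP: "spherical_angle P Q R = \<alpha> / 2"
    unfolding angle[OF PP QQ RR] PR QR q by (rule ax)
  have aQ: "spherical_angle Q R P = \<alpha> / 2"
    unfolding angle[OF QQ RR PP] QR inner_commute[of R P] PR inner_commute[of Q P]
    using q ax by (simp add: mult.commute)
  have "P \<bullet> (Q \<times> R) = s\<^sup>2 * z / 2"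
    by (simp add: PQR ev cross3_def power2_eq_square)
  moreover have "s\<^sup>2 * z / 2 > 0" using s z by simp
  ultimately have "P \<bullet> (Q \<times> R) \<noteq> 0" by linarith
  then have "cone_triangle \<alpha> P Q R"
    using PP QQ RR aP aQ aR by (simp add: cone_triangle_def norm_eq_1)
  then show ?thesis by blast
qed

end

theory Submission
  imports Defs
begin

text \<open>
  Both groups are generated by two rotations of angle \<open>\<alpha>\<close>. By the dual spherical law of cosines the
  axes \<open>P\<close> and \<open>Q\<close> satisfy \<open>(1 - x\<^sup>2) (P \<bullet> Q) = x\<^sup>2 - 1 / 2\<close>, and the axes of \<open>\<rho>\<^sub>x(a)\<close> and
  \<open>\<rho>\<^sub>x(b)\<close> enclose the same angle. Hence some rotation carries one pair of axes to the other, and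
  conjugation by it carries one group to the other.
\<close>

section \<open>Generated subgroups and the image of the trefoil group\<close>

lemma image_word_eval:
  assumes "group H" "\<And>g. f g \<in> carrier H"
  shows "range (word_eval H f) = generate H (range f)"
proof
  interpret H: group H by fact
  show "range (word_eval H f) \<subseteq> generate H (range f)"
  proof (rule image_subsetI)
    fix w
    show "word_eval H f w \<in> generate H (range f)"
    proof (induction w)
      case Nil
      show ?case by (simp add: generate.one)
    next
      case (Cons l w)
      obtain g e where l: "l = (g, e)" by (cases l)
      have "(if e then f g else inv\<^bsub>H\<^esub> (f g)) \<in> generate H (range f)"
        by (simp add: generate.incl generate.inv)
      then show ?case
        using Cons by (simp add: l generate.eng del: if_split)
    qed
  qed
  show "generate H (range f) \<subseteq> range (word_eval H f)"
  proof
    fix h assume "h \<in> generate H (range f)"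
    then show "h \<in> range (word_eval H f)"
    proof (induction rule: generate.induct)
      case one
      show ?case by (rule range_eqI[of _ _ "[]"]) simp
    next
      case (incl h)
      then obtain g where "h = f g" by blast
      then show ?case
        by (intro range_eqI[of _ _ "[(g, True)]"]) (simp add: assms(2))
    next
      case (inv h)
      then obtain g where "h = f g" by blast
      then show ?case
        by (intro range_eqI[of _ _ "[(g, False)]"]) (simp add: assms(2))
    next
      case (eng h1 h2)
      then obtain u v where "h1 = word_eval H f u" "h2 = word_eval H f v" by blast
      then show ?case
        using word_eval_append[of H f u v, OF assms] by (intro range_eqI[of _ _ "u @ v"]) simp
    qed
  qed
qed

text \<open>Conjugation by \<open>g\<close> is an injective endomorphism, and homomorphisms carry
  generated subgroups to the subgroups generated by the images. In \<open>theorem2\<close>,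
  \<open>g\<close> is the rotation that aligns the two pairs of axes.\<close>

lemma (in group) generate_conj_iso:
  assumes "g \<in> carrier G" "S \<subseteq> carrier G"
  shows "G\<lparr>carrier := generate G S\<rparr> \<cong>
    G\<lparr>carrier := generate G ((\<lambda>h. g \<otimes> h \<otimes> inv g) ` S)\<rparr>"
proof -
  let ?c = "\<lambda>h. g \<otimes> h \<otimes> inv g"
  have hom: "?c \<in> hom G G"
    using assms(1) by (auto intro!: homI simp: m_assoc inv_solve_left' simp flip: m_assoc[of "inv g" g])
  then interpret c: group_hom G G ?c
    by unfold_locales
  have img: "?c ` generate G S = generate G (?c ` S)"
    using assms(2) by (rule c.generate_img[symmetric])
  have sub: "generate G S \<subseteq> carrier G"
    using assms(2) by (rule generate_incl)
  have "inj_on ?c (carrier G)"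
    using assms(1) by (auto intro!: inj_onI simp: m_assoc)
  then have "inj_on ?c (generate G S)"
    using sub by (rule inj_on_subset)
  then have "?c \<in> iso (G\<lparr>carrier := generate G S\<rparr>) (G\<lparr>carrier := generate G (?c ` S)\<rparr>)"
    using img sub by (auto simp: iso_def bij_betw_def intro!: homI c.hom_mult)
  then show ?thesis
    by (rule is_isoI)
qed

text \<open>Each group element is the class of a word, and the induced map evaluates that word. The
  image in \<open>S3\<close> therefore consists of all word values, i.e. of the subgroup generated
  by the two quaternions, and \<open>quat_conj\<close> pushes these generators to
  \<open>SO3\<close>.\<close>

lemma trefoil_image_eq_generate:
  assumes "- (sqrt 3 / 2) < x" "x < sqrt 3 / 2"
  shows "(quat_conj \<circ> trefoil_rep x) ` carrier trefoil_group =
    generate SO3 {quat_conj (trefoil_gen_image x Gen_a), quat_conj (trefoil_gen_image x Gen_b)}"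
proof -
  let ?R = "{([(Gen_a, True), (Gen_b, True), (Gen_a, True)],
    [(Gen_b, True), (Gen_a, True), (Gen_b, True)])}"
  note S3_gen = trefoil_gen_image_S3[OF assms]
  have rel: "word_eval S3 (trefoil_gen_image x) r = word_eval S3 (trefoil_gen_image x) s"
    if "(r, s) \<in> ?R" for r s
    using that trefoil_rep_relation[OF assms] by (simp add: S3_def del: trefoil_gen_image.simps)
  have "trefoil_rep x ` carrier trefoil_group = range (word_eval S3 (trefoil_gen_image x))"
    unfolding trefoil_rep_def trefoil_group_def presented_group_carrier image_image
    by (subst induced_map_class[OF group_S3 S3_gen rel]) simp_all
  also have "\<dots> = generate S3 (range (trefoil_gen_image x))"
    by (rule image_word_eval[OF group_S3 S3_gen])
  finally have "(quat_conj \<circ> trefoil_rep x) ` carrier trefoil_group =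
      quat_conj ` generate S3 (range (trefoil_gen_image x))"
    by (simp only: image_comp[symmetric])
  also have "\<dots> = generate SO3 (quat_conj ` range (trefoil_gen_image x))"
    using S3_gen
    by (intro group_hom.generate_img[symmetric])
      (auto simp: group_hom_def group_hom_axioms_def group_S3 group_SO3 quat_conj_hom)
  also have "range (trefoil_gen_image x) = {trefoil_gen_image x Gen_a, trefoil_gen_image x Gen_b}"
  proof -
    have "UNIV = {Gen_a, Gen_b}"
      using trefoil_gen.exhaust by blast
    then show ?thesis
      by (metis image_empty image_insert)
  qed
  finally show ?thesis by simp
qed

section \<open>Rotations about axes and spherical trigonometry\<close>

lemma axis_rotation_conj:
  assumes "f \<in> carrier SO3"
  shows "f \<circ> axis_rotation p \<theta> = axis_rotation (f p) \<theta> \<circ> f"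
proof
  fix v
  have f: "orthogonal_transformation f" "det (matrix f) = 1"
    using assms by (simp_all add: SO3_def)
  then interpret linear f by (simp add: orthogonal_transformation_linear)
  \<comment> \<open>Rodrigues' formula is built from the linear structure, the inner product and the
    cross product. Determinant 1 fixes the sign with which an orthogonal map acts on the cross
    product.\<close>
  have "f p \<times> f v = f (p \<times> v)"
    using f cross_orthogonal_transformation[of f p v] by simp
  moreover have "f p \<bullet> f v = p \<bullet> v"
    using f by (simp add: orthogonal_transformation_def)
  ultimately show "(f \<circ> axis_rotation p \<theta>) v = (axis_rotation (f p) \<theta> \<circ> f) v"
    by (simp add: axis_rotation_def add scale)
qed

text \<open>This is the spherical law of cosines. Projecting \<open>B\<close> and \<open>C\<close>
  to the plane orthogonal to \<open>A\<close> leaves vectors whose lengths are the sines of the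
  adjacent sides.\<close>

lemma cos_spherical_angle:
  assumes "norm A = 1" "norm B = 1" "norm C = 1"
  shows "B \<bullet> C - (A \<bullet> B) * (A \<bullet> C) =
    cos (spherical_angle A B C) * sqrt (1 - (A \<bullet> B)\<^sup>2) * sqrt (1 - (A \<bullet> C)\<^sup>2)"
proof -
  define u where "u = B - (A \<bullet> B) *\<^sub>R A"
  define v where "v = C - (A \<bullet> C) *\<^sub>R A"
  have unit: "A \<bullet> A = 1" "B \<bullet> B = 1" "C \<bullet> C = 1"
    using assms by (simp_all add: norm_eq_1)
  have nu: "norm u = sqrt (1 - (A \<bullet> B)\<^sup>2)" and nv: "norm v = sqrt (1 - (A \<bullet> C)\<^sup>2)"
    using unit by (simp_all add: u_def v_def norm_eq_sqrt_inner inner_diff_left inner_diff_right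
        inner_commute power2_eq_square)
  have "\<bar>u \<bullet> v\<bar> \<le> norm u * norm v"
    by (rule Cauchy_Schwarz_ineq2)
  then have "\<bar>(u \<bullet> v) / (norm u * norm v)\<bar> \<le> 1"
    by (simp add: divide_le_eq_1_pos divide_le_eq)
  then have "cos (spherical_angle A B C) = (u \<bullet> v) / (norm u * norm v)"
    by (simp add: spherical_angle_def Let_def u_def v_def cos_arccos_abs)
  \<comment> \<open>If \<open>u\<close> or \<open>v\<close> is zero, both sides vanish, so clearing
    the denominator needs no case of its own.\<close>
  then have "u \<bullet> v = cos (spherical_angle A B C) * norm u * norm v"
    by auto
  moreover have "u \<bullet> v = B \<bullet> C - (A \<bullet> B) * (A \<bullet> C)"
    using unit by (simp add: u_def v_def inner_diff_left inner_diff_right inner_commute)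
  ultimately show ?thesis by (simp add: nu nv)
qed

text \<open>The squared triple product is the Gram determinant of the three vectors.\<close>

lemma triple_product_power2:
  fixes P Q R :: "real ^ 3"
  assumes "norm P = 1" "norm Q = 1" "norm R = 1"
  shows "(P \<bullet> (Q \<times> R))\<^sup>2 = 1 - (P \<bullet> R)\<^sup>2 - (Q \<bullet> R)\<^sup>2 - (P \<bullet> Q)\<^sup>2 +
    2 * (P \<bullet> R) * (Q \<bullet> R) * (P \<bullet> Q)"
proof -
  have "(P \<bullet> (Q \<times> R))\<^sup>2 = (P \<bullet> P) * (Q \<bullet> Q) * (R \<bullet> R) - (Q \<bullet> Q) * (P \<bullet> R)\<^sup>2
      - (P \<bullet> P) * (Q \<bullet> R)\<^sup>2 - (R \<bullet> R) * (P \<bullet> Q)\<^sup>2 + 2 * (P \<bullet> R) * (Q \<bullet> R) * (P \<bullet> Q)"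
    unfolding cross3_def inner_vec_def sum_3 vector_3 inner_real_def by Groebner_Basis.algebra
  then show ?thesis using assms by (simp add: norm_eq_1)
qed

text \<open>The Gram determinant \<open>D\<close> combines the ordinary laws of cosines at the three
  vertices into the dual law, which determines the side \<open>PQ\<close> from the angles alone. The
  angle at \<open>R\<close> contributes the constant \<open>1 / 2\<close>.\<close>

lemma cone_triangle_inner:
  assumes "cone_triangle \<alpha> P Q R"
  shows "(1 - (cos (\<alpha> / 2))\<^sup>2) * (P \<bullet> Q) = (cos (\<alpha> / 2))\<^sup>2 - 1 / 2"
    and "(P \<bullet> Q)\<^sup>2 < 1"
proof -
  define x where "x = cos (\<alpha> / 2)"
  \<comment> \<open>Lower case letters are the cosines of the sides \<open>PR\<close>,
    \<open>QR\<close>, \<open>PQ\<close>; the corresponding capitals are their sines.\<close>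
  define a where "a = P \<bullet> R"
  define b where "b = Q \<bullet> R"
  define c where "c = P \<bullet> Q"
  define A where "A = sqrt (1 - a\<^sup>2)"
  define B where "B = sqrt (1 - b\<^sup>2)"
  define C where "C = sqrt (1 - c\<^sup>2)"
  define D where "D = (P \<bullet> (Q \<times> R))\<^sup>2"
  have n: "norm P = 1" "norm Q = 1" "norm R = 1"
    using assms by (simp_all add: cone_triangle_def)
  have D: "D = 1 - a\<^sup>2 - b\<^sup>2 - c\<^sup>2 + 2 * a * b * c"
    unfolding D_def a_def b_def c_def by (rule triple_product_power2[OF n])
  have "D > 0"
    using assms by (simp add: cone_triangle_def D_def)
  have le: "(u \<bullet> v)\<^sup>2 \<le> 1" if "norm u = 1" "norm v = 1" for u v :: "real ^ 3"
    using Cauchy_Schwarz_ineq[of u v] that by (simp add: norm_eq_1)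
  have "a\<^sup>2 \<le> 1" "b\<^sup>2 \<le> 1" "c\<^sup>2 \<le> 1"
    using n by (simp_all add: a_def b_def c_def le)
  then have sq: "A\<^sup>2 = 1 - a\<^sup>2" "B\<^sup>2 = 1 - b\<^sup>2" "C\<^sup>2 = 1 - c\<^sup>2"
      and ge: "A \<ge> 0" "B \<ge> 0" "C \<ge> 0"
    by (simp_all add: A_def B_def C_def)
  \<comment> \<open>The subtracted squares are those of the left sides of the laws of cosines at
    \<open>R\<close>, \<open>P\<close> and \<open>Q\<close>. Positivity of \<open>D\<close> then
    forces all three sines to be nonzero.\<close>
  have DAB: "D = A\<^sup>2 * B\<^sup>2 - (c - a * b)\<^sup>2" and DAC: "D = A\<^sup>2 * C\<^sup>2 - (b - a * c)\<^sup>2"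
    and DBC: "D = B\<^sup>2 * C\<^sup>2 - (a - b * c)\<^sup>2"
    unfolding D sq by (simp_all add: power2_eq_square algebra_simps)
  have ne: "A \<noteq> 0" "B \<noteq> 0" "C \<noteq> 0"
    using \<open>D > 0\<close> DAB DAC zero_le_power2[of "c - a * b"] zero_le_power2[of "b - a * c"]
    by (smt (verit) mult_eq_0_iff zero_power2)+
  from ne(3) ge(3) have "C\<^sup>2 > 0" by simp
  then show "(P \<bullet> Q)\<^sup>2 < 1" using sq by (simp add: c_def)
  have angles: "cos (spherical_angle R P Q) = - (1 / 2)" "cos (spherical_angle P Q R) = x"
      "cos (spherical_angle Q R P) = x"
    using assms cos_120 by (simp_all only: cone_triangle_def x_def)
  have R: "c - a * b = - (1 / 2) * A * B"
    using cos_spherical_angle[OF n(3,1,2)]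
    by (simp add: angles inner_commute a_def b_def c_def A_def B_def)
  have P: "b - a * c = x * C * A"
    using cos_spherical_angle[OF n]
    by (simp add: angles inner_commute a_def b_def c_def A_def C_def mult_ac)
  have Q: "a - b * c = x * B * C"
    using cos_spherical_angle[OF n(2,3,1)]
    by (simp add: angles inner_commute a_def b_def c_def B_def C_def mult_ac)
  have DA: "D = (A * C)\<^sup>2 * (1 - x\<^sup>2)" and DB: "D = (B * C)\<^sup>2 * (1 - x\<^sup>2)"
    using DAC DBC unfolding P Q by (simp_all add: power_mult_distrib algebra_simps)
  \<comment> \<open>Equal angles at \<open>P\<close> and \<open>Q\<close> give two expressions for
    \<open>D\<close> that differ only in \<open>A\<close> and \<open>B\<close>, so the sides
    \<open>PR\<close> and \<open>QR\<close> have equal sines.\<close>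
  with \<open>D > 0\<close> have "1 - x\<^sup>2 \<noteq> 0" by auto
  with DA DB ne ge have "A = B"
    by (simp add: power_mult_distrib)
  \<comment> \<open>Inserting the laws of cosines into this polynomial identity and cancelling the
    sines yields the dual law.\<close>
  have "(c - a * b) * C\<^sup>2 + (b - a * c) * (a - b * c) = c * D"
    unfolding D sq by (simp add: power2_eq_square algebra_simps)
  then have "(A * C)\<^sup>2 * (x\<^sup>2 - 1 / 2) = (A * C)\<^sup>2 * ((1 - x\<^sup>2) * c)"
    unfolding R P Q DA \<open>A = B\<close> by (simp add: power2_eq_square algebra_simps)
  then show "(1 - (cos (\<alpha> / 2))\<^sup>2) * (P \<bullet> Q) = (cos (\<alpha> / 2))\<^sup>2 - 1 / 2"
    using ne by (simp add: x_def c_def)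
qed

section \<open>Aligning the axes and comparing the two groups\<close>

lemma rotation_to_standard_position:
  fixes P Q :: "real ^ 3"
  assumes "norm P = 1" "norm Q = 1" "(P \<bullet> Q)\<^sup>2 < 1"
  obtains f where "f \<in> carrier SO3" "f Q = vector [1, 0, 0]"
    "f P = vector [P \<bullet> Q, sqrt (1 - (P \<bullet> Q)\<^sup>2), 0]"
proof -
  define c where "c = P \<bullet> Q"
  define s where "s = sqrt (1 - c\<^sup>2)"
  have s2: "s * s = 1 - c\<^sup>2" and s: "s \<noteq> 0"
    using assms(3) by (simp_all add: s_def c_def)
  have unit: "P \<bullet> P = 1" "Q \<bullet> Q = 1" "Q \<bullet> P = c" "P \<bullet> Q = c"
    using assms by (simp_all add: norm_eq_1 c_def inner_commute)
  \<comment> \<open>Gram-Schmidt applied to \<open>Q\<close>, \<open>P\<close> gives the unit vector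
    \<open>e\<close>. The matrix with rows \<open>Q\<close>, \<open>e\<close>,
    \<open>Q \<times> e\<close> sends a vector to its coordinates in this positively oriented
    frame.\<close>
  define e where "e = (P - c *\<^sub>R Q) /\<^sub>R s"
  define M :: "real ^ 3 ^ 3" where "M = vector [Q, e, Q \<times> e]"
  have Qe: "Q \<bullet> e = 0"
    using unit by (simp add: e_def inner_diff_right)
  have Pe: "e \<bullet> P = s"
    using unit s2 s by (simp add: e_def inner_diff_left power2_eq_square field_simps)
  have ee: "e \<bullet> e = 1"
  proof -
    have "e \<bullet> e = (e \<bullet> P - c * (e \<bullet> Q)) / s"
      by (subst (2) e_def) (simp add: inner_diff_right divide_inverse mult.commute)
    then show ?thesis using Qe Pe s by (simp add: inner_commute)
  qed
  have cross: "(Q \<times> e) \<bullet> (Q \<times> e) = 1"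
    using norm_cross_dot[of Q e] unit ee Qe by (simp add: norm_eq_1[symmetric] power2_eq_1_iff)
  have "Q \<times> P = s *\<^sub>R (Q \<times> e)"
    using s by (simp add: e_def cross_mult_right Cross3.right_diff_distrib)
  have xP: "(Q \<times> e) \<bullet> P = 0"
  proof -
    have "P = s *\<^sub>R e + c *\<^sub>R Q" using s by (simp add: e_def)
    then show ?thesis by (metis dot_cross_self inner_add_right inner_scaleR_right add_0 mult_zero_right)
  qed
  have ap: "(M *v w) = vector [Q \<bullet> w, e \<bullet> w, (Q \<times> e) \<bullet> w]" for w
    by (simp add: M_def matrix_vector_mul_component vec_eq_iff forall_3)
  have "orthogonal_matrix M"
    unfolding orthogonal_matrix_orthonormal_rows
    using unit ee Qe cross
    by (auto simp: forall_3 row_def M_def orthogonal_def dot_cross_self norm_eq_1 inner_commute)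
  moreover have "det M = (Q \<times> e) \<bullet> (Q \<times> e)"
    unfolding M_def det_3 vector_3 cross3_def inner_vec_def sum_3 inner_real_def
    by Groebner_Basis.algebra
  ultimately have "(*v) M \<in> carrier SO3"
    using cross by (simp add: SO3_def orthogonal_transformation_matrix)
  moreover have "M *v Q = vector [1, 0, 0]" "M *v P = vector [c, s, 0]"
    using unit Qe Pe xP by (simp_all add: ap inner_commute dot_cross_self)
  ultimately show thesis
    using that[of "(*v) M"] by (simp add: c_def s_def)
qed

theorem theorem2:
  fixes x \<alpha> :: real and P Q R :: "real ^ 3"
  assumes "- (sqrt 3 / 2) < x" and "x < sqrt 3 / 2"
    and "x = cos (\<alpha> / 2)"
    and "10 * pi / 6 > \<alpha>" and "\<alpha> > 2 * pi / 6"
    and "cone_triangle \<alpha> P Q R"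
  shows "SO3\<lparr>carrier := (quat_conj \<circ> trefoil_rep x) ` carrier trefoil_group\<rparr>
           \<cong> SO3\<lparr>carrier := cone_holonomy \<alpha> P Q\<rparr>"
proof -
  interpret SO3: group SO3 by (rule group_SO3)
  have n: "norm P = 1" "norm Q = 1"
    using assms(6) by (simp_all add: cone_triangle_def)
  define c where "c = P \<bullet> Q"
  define s where "s = sin (\<alpha> / 2)"
  have c1: "c\<^sup>2 < 1" and c: "(1 - x\<^sup>2) * c = x\<^sup>2 - 1 / 2"
    using cone_triangle_inner[OF assms(6)] by (simp_all add: c_def assms(3))
  obtain f where f: "f \<in> carrier SO3" "f Q = vector [1, 0, 0]" "f P = vector [c, sqrt (1 - c\<^sup>2), 0]"
    using rotation_to_standard_position[OF n] c1 unfolding c_def by blast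
  \<comment> \<open>Since \<open>\<alpha> / 2\<close> lies strictly between 0 and \<open>pi\<close>,
    \<open>s\<close> is the positive root of \<open>1 - x\<^sup>2\<close>, as in the coefficients of
    the representation.\<close>
  have "s > 0"
    unfolding s_def using assms(4,5) by (intro sin_gt_zero) auto
  have s2: "s\<^sup>2 = 1 - x\<^sup>2"
    by (simp add: s_def assms(3) sin_squared_eq)
  with \<open>s > 0\<close> have s: "s = sqrt (1 - x\<^sup>2)"
    by (metis less_imp_le real_sqrt_unique)
  \<comment> \<open>The rotation of angle \<open>\<alpha>\<close> about \<open>f P\<close> comes
    from the quaternion with real part \<open>x\<close> and pure part \<open>s\<close> times
    \<open>f P\<close>. Hence \<open>sc\<close> and \<open>st\<close> match the \<open>i\<close> and
    \<open>j\<close> coefficients of the image of \<open>Gen_a\<close>.\<close>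
  have sc: "s * c = (2 * x\<^sup>2 - 1) / (2 * s)"
    using c \<open>s > 0\<close> unfolding s2[symmetric] by (simp add: power2_eq_square field_simps)
  \<comment> \<open>A difference of squares: \<open>(1 - x\<^sup>2)\<^sup>2 - (x\<^sup>2 - 1 /
    2)\<^sup>2 = 3 / 4 - x\<^sup>2\<close>.\<close>
  have "4 * s\<^sup>2 * (s\<^sup>2 * (1 - c\<^sup>2)) = 3 - 4 * x\<^sup>2"
    using c unfolding s2 by Groebner_Basis.algebra
  then have "s\<^sup>2 * (1 - c\<^sup>2) = (1 / 2)\<^sup>2 * ((3 - 4 * x\<^sup>2) / s\<^sup>2)"
    using \<open>s > 0\<close> by (simp add: field_simps)
  then have "sqrt (s\<^sup>2 * (1 - c\<^sup>2)) = sqrt ((1 / 2)\<^sup>2 * ((3 - 4 * x\<^sup>2) / s\<^sup>2))"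
    by simp
  then have st: "s * sqrt (1 - c\<^sup>2) = 1 / 2 * sqrt ((3 - 4 * x\<^sup>2) / (1 - x\<^sup>2))"
    using \<open>s > 0\<close> unfolding s2[symmetric] real_sqrt_mult by simp
  have nf: "norm (f w) = norm w" for w
    using f(1) by (simp add: SO3_def orthogonal_transformation)
  have a: "quat_conj (trefoil_gen_image x Gen_a) = axis_rotation (f P) \<alpha>"
    unfolding axis_rotation_eq_quat_conj[OF nf[of P, unfolded n(1)]]
    using sc st[symmetric] by (simp add: f s_def[symmetric] assms(3)[symmetric] s[symmetric])
  have b: "quat_conj (trefoil_gen_image x Gen_b) = axis_rotation (f Q) \<alpha>"
    unfolding axis_rotation_eq_quat_conj[OF nf[of Q, unfolded n(2)]]
    by (simp add: f s_def[symmetric] assms(3)[symmetric] s[symmetric])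
  have conj: "f \<otimes>\<^bsub>SO3\<^esub> axis_rotation p \<alpha> \<otimes>\<^bsub>SO3\<^esub> inv\<^bsub>SO3\<^esub> f = axis_rotation (f p) \<alpha>"
    if "norm p = 1" for p
  proof -
    have "f \<otimes>\<^bsub>SO3\<^esub> axis_rotation p \<alpha> = axis_rotation (f p) \<alpha> \<otimes>\<^bsub>SO3\<^esub> f"
      using axis_rotation_conj[OF f(1)] by (simp add: SO3_def)
    then show ?thesis
      using f(1) that nf by (simp add: SO3.m_assoc axis_rotation_SO3)
  qed
  have mem: "{axis_rotation P \<alpha>, axis_rotation Q \<alpha>} \<subseteq> carrier SO3"
    using n by (simp add: axis_rotation_SO3)
  have "SO3\<lparr>carrier := cone_holonomy \<alpha> P Q\<rparr> \<cong>
      SO3\<lparr>carrier := (quat_conj \<circ> trefoil_rep x) ` carrier trefoil_group\<rparr>"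
    using SO3.generate_conj_iso[OF f(1) mem] n
    unfolding trefoil_image_eq_generate[OF assms(1,2)] a b cone_holonomy_def
    by (simp add: conj)
  \<comment> \<open>Conjugation by \<open>f\<close> maps the holonomy onto the image, so the
    isomorphism must be reversed, and \<open>group.iso_sym\<close> asks for a group as its
    source.\<close>
  moreover have "group (SO3\<lparr>carrier := cone_holonomy \<alpha> P Q\<rparr>)"
    unfolding cone_holonomy_def
    using SO3.generate_is_subgroup[OF mem] by (rule SO3.subgroup_imp_group)
  ultimately show ?thesis
    by (simp add: group.iso_sym)
qed

end
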